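(* For all integers $n\ge 0$ and $l\ge 1$, $$B_n^{2l}=\frac{2}{2^{5l}}\sum_{0\le s<l}\frac{(-1)^s\binom{2l}{s}}{B_{2(l-s)}}\Big(B_{2(l-s)n}+B_{2(l-s)(n+1)}\Big)+\frac{1}{2^{5l}}\sum_{0\le s<l}\frac{(-1)^{s-1}\binom{2l}{s}B_{2(l-s)}}{B_{l-s}^2}B_{2(l-s)n}+\frac{(-1)^l}{2^{5l}}\binom{2l}{l}.$$
   Context: The balancing numbers $(B_n)_{n\ge 0}$ are defined by $B_0=0$, $B_1=1$ and $B_n=6B_{n-1}-B_{n-2}$ for $n\ge 2$. The identity is between rational numbers; $B_n^{2l}$ denotes the $2l$-th power of $B_n$, and $B_{l-s}^2$ the square of $B_{l-s}$. For $s=0$, $(-1)^{s-1}$ means $-1$. *)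

theory Defs
  imports Complex_Main
begin

fun balancing :: "nat \<Rightarrow> int" where
  "balancing 0 = 0"
| "balancing (Suc 0) = 1"
| "balancing (Suc (Suc n)) = 6 * balancing (Suc n) - balancing n"

abbreviation B :: "nat \<Rightarrow> rat" where
  "B n \<equiv> of_int (balancing n)"

end

theory Submission imports Defs
begin

text \<open>
  Write \<open>\<alpha> = 3 + 2\<surd>2\<close> and \<open>\<beta> = 3 - 2\<surd>2\<close>, the roots of \<open>x\<^sup>2 = 6x - 1\<close>, so that
  \<open>\<alpha>\<beta> = 1\<close>, \<open>(\<alpha> - \<beta>)\<^sup>2 = 32\<close> and \<open>B n = (\<alpha>\<^sup>n - \<beta>\<^sup>n) / (\<alpha> - \<beta>)\<close> (\<open>balancing_Binet\<close>).
  Expanding \<open>(\<alpha>\<^sup>n - \<beta>\<^sup>n)\<close> to the power \<open>2l\<close> by the binomial theorem and pairing the terms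
  of index \<open>s\<close> and \<open>2l - s\<close> (\<open>even_power_diff_reciprocal\<close>) gives a combination of the companion
  numbers \<open>\<alpha>\<^sup>k + \<beta>\<^sup>k\<close> with \<open>k = 2(l - s)n\<close>, together with the middle term
  \<open>(-1)\<^sup>l (2l choose l)\<close>; the factor \<open>1 / 2\<^bsup>5l\<^esup>\<close> is \<open>1 / (\<alpha> - \<beta>)\<^bsup>2l\<^esup>\<close>.

  What remains is to express each companion number through balancing numbers, namely,
  with \<open>m = l - s\<close>,
  \<open>\<alpha>\<^bsup>2mn\<^esup> + \<beta>\<^bsup>2mn\<^esup> = 2 (B (2mn) + B (2m(n+1))) / B (2m) - B (2m) B (2mn) / (B m)\<^sup>2\<close>
  (\<open>companion_as_balancing\<close>). The two sums of the theorem are the two parts of this expression.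
  The irrational \<open>\<surd>2\<close> cancels in the end, so the computation is done in the reals and the
  result is pulled back along the embedding of the rationals.
\<close>

abbreviation balancing_root :: real ("\<alpha>")
  where "\<alpha> \<equiv> 3 + 2 * sqrt 2"

abbreviation balancing_conj :: real ("\<beta>")
  where "\<beta> \<equiv> 3 - 2 * sqrt 2"

lemma balancing_roots_mult: "\<alpha> * \<beta> = 1"
  by (simp add: algebra_simps)

lemma balancing_roots_diff_power: "(\<alpha> - \<beta>) ^ (2 * l) = 2 ^ (5 * l)"
proof -
  have "(\<alpha> - \<beta>)\<^sup>2 = 2 ^ 5" by (simp add: power_mult_distrib)
  then show ?thesis by (metis power_mult)
qed

lemma balancing_Binet: "real_of_int (balancing n) = (\<alpha> ^ n - \<beta> ^ n) / (\<alpha> - \<beta>)"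
proof (induction n rule: balancing.induct)
  case (3 n)
  have "\<alpha> ^ Suc (Suc n) = 6 * \<alpha> ^ Suc n - \<alpha> ^ n" "\<beta> ^ Suc (Suc n) = 6 * \<beta> ^ Suc n - \<beta> ^ n"
    by (simp_all add: algebra_simps)
  then show ?case using 3 by (simp add: field_simps del: power_Suc)
qed simp_all

text \<open>
  The binomial expansion is invariant under \<open>s \<mapsto> 2l - s\<close> up to exchanging \<open>u\<close> and \<open>v\<close>,
  because the exponent \<open>2l\<close> is even; and since \<open>uv = 1\<close>, the common factor \<open>(uv)\<^sup>s\<close>
  of the two paired terms disappears.
\<close>

lemma even_power_diff_reciprocal:
  fixes u v :: "'a::comm_ring_1"
  assumes uv: "u * v = 1"
  shows "(u - v) ^ (2 * l) =
    (\<Sum>s<l. (-1) ^ s * of_nat ((2 * l) choose s) * (u ^ (2 * (l - s)) + v ^ (2 * (l - s))))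
    + (-1) ^ l * of_nat ((2 * l) choose l)"
proof -
  define t where "t s = of_nat ((2 * l) choose s) * (-v) ^ s * u ^ (2 * l - s)" for s
  have t: "t s = (-1) ^ s * of_nat ((2 * l) choose s) * (v ^ s * u ^ (2 * l - s))" for s
    unfolding t_def power_minus[of v] by (simp only: mult_ac)
  have cancel: "v ^ s * u ^ (s + k) = u ^ k" "v ^ (s + k) * u ^ s = v ^ k" for s k
  proof -
    have "v ^ s * u ^ s = 1" using uv by (simp add: mult.commute flip: power_mult_distrib)
    then show "v ^ s * u ^ (s + k) = u ^ k" "v ^ (s + k) * u ^ s = v ^ k"
      by (simp_all add: power_add algebra_simps)
        (metis mult.assoc mult.commute mult.right_neutral)+
  qed
  have lower: "t s = (-1) ^ s * of_nat ((2 * l) choose s) * u ^ (2 * (l - s))" if "s < l" for s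
  proof -
    have "2 * l - s = s + 2 * (l - s)" using that by simp
    then show ?thesis by (simp only: t cancel)
  qed
  have upper: "t (2 * l - s) = (-1) ^ s * of_nat ((2 * l) choose s) * v ^ (2 * (l - s))"
    if "s < l" for s
  proof -
    have "2 * l - s = s + 2 * (l - s)" "2 * l - (2 * l - s) = s" using that by simp_all
    moreover have "(2 * l) choose (2 * l - s) = (2 * l) choose s"
      using that by (simp add: binomial_symmetric[of s])
    moreover have "(-1) ^ (2 * l - s) = ((-1) ^ s :: 'a)"
      using that by (simp add: minus_one_power_iff)
    ultimately show ?thesis using cancel(2)[of s "2 * (l - s)"] by (simp only: t)
  qed
  have middle: "t l = (-1) ^ l * of_nat ((2 * l) choose l)"
    using cancel(1)[of l 0] by (simp add: t)
  have "(u - v) ^ (2 * l) = (\<Sum>s\<le>2 * l. t s)"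
    using binomial_ring[of "-v" u "2 * l"] by (simp add: t_def)
  also have "{..2 * l} = {..<l} \<union> {l} \<union> {l<..2 * l}" by auto
  also have "sum t \<dots> = sum t {..<l} + t l + sum t {l<..2 * l}"
    by (subst sum.union_disjoint, auto)+
  also have "sum t {l<..2 * l} = (\<Sum>s<l. t (2 * l - s))"
    by (rule sum.reindex_bij_witness[of _ "\<lambda>s. 2 * l - s" "\<lambda>s. 2 * l - s"]) auto
  also have "sum t {..<l} + t l + \<dots> = (\<Sum>s<l. t s + t (2 * l - s)) + t l"
    by (simp add: sum.distrib)
  finally show ?thesis
    by (simp add: lower upper middle distrib_left)
qed

text \<open>
  Put \<open>x = \<alpha>\<^sup>m\<close>, \<open>y = \<beta>\<^sup>m\<close>, \<open>u = \<alpha>\<^bsup>2mn\<^esup>\<close>, \<open>v = \<beta>\<^bsup>2mn\<^esup>\<close>. Since \<open>xy = 1\<close>,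
  \<open>1 + x\<^sup>2 = x(x + y)\<close> and \<open>1 + y\<^sup>2 = y(x + y)\<close>, so the factor \<open>x + y\<close> cancels in the first
  quotient, which becomes \<open>2(ux - vy) / (x - y)\<close>. The second one is
  \<open>(x + y)(u - v) / (x - y)\<close>, and the difference of the numerators is \<open>(u + v)(x - y)\<close>.
\<close>

lemma companion_as_balancing:
  assumes "m \<ge> 1"
  shows "\<alpha> ^ (2 * m * n) + \<beta> ^ (2 * m * n) =
    2 / real_of_int (balancing (2 * m)) *
      (real_of_int (balancing (2 * m * n)) + real_of_int (balancing (2 * m * (n + 1))))
    - real_of_int (balancing (2 * m)) / (real_of_int (balancing m))\<^sup>2
      * real_of_int (balancing (2 * m * n))"
proof -
  define x y u v d where
    "x = \<alpha> ^ m" and "y = \<beta> ^ m" and "u = \<alpha> ^ (2 * m * n)" and "v = \<beta> ^ (2 * m * n)"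
    and "d = \<alpha> - \<beta>"
  have d: "d \<noteq> 0" by (simp add: d_def)
  have xy: "x * y = 1"
    unfolding x_def y_def by (simp only: balancing_roots_mult power_one flip: power_mult_distrib)
  have beta: "0 < \<beta>"
  proof (rule zero_less_mult_pos)
    show "0 < \<alpha> * \<beta>" by (simp only: balancing_roots_mult zero_less_one)
    show "0 < \<alpha>" by (simp add: add_pos_nonneg)
  qed
  have "y < x"
    unfolding x_def y_def by (rule power_strict_mono) (use beta assms in auto)
  moreover have "0 < y" using beta by (simp add: y_def)
  ultimately have nz: "x - y \<noteq> 0" "x + y \<noteq> 0" by auto
  have Bm: "real_of_int (balancing m) = (x - y) / d"
    by (simp only: balancing_Binet x_def y_def d_def)
  have "\<alpha> ^ (2 * m) = x\<^sup>2" "\<beta> ^ (2 * m) = y\<^sup>2"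
    unfolding x_def y_def by (simp_all add: mult.commute flip: power_mult)
  then have B2m: "real_of_int (balancing (2 * m)) = (x - y) * (x + y) / d"
    and Bnext: "real_of_int (balancing (2 * m * (n + 1))) = (u * x\<^sup>2 - v * y\<^sup>2) / d"
    unfolding balancing_Binet u_def v_def d_def
    by (simp_all only: distrib_left power_add mult_1_right) (simp add: power2_eq_square algebra_simps)
  have B2mn: "real_of_int (balancing (2 * m * n)) = (u - v) / d"
    by (simp only: balancing_Binet u_def v_def d_def)
  have "u - v + (u * x\<^sup>2 - v * y\<^sup>2) = (x + y) * (u * x - v * y)"
    using xy by algebra
  then have "2 / ((x - y) * (x + y) / d) * ((u - v) / d + (u * x\<^sup>2 - v * y\<^sup>2) / d)
      = 2 * (u * x - v * y) / (x - y)"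
    using nz d by (simp flip: add_divide_distrib)
  moreover have "(x - y) * (x + y) / d / ((x - y) / d)\<^sup>2 * ((u - v) / d)
      = (x + y) * (u - v) / (x - y)"
    using nz d by (simp add: power2_eq_square)
  moreover have "2 * (u * x - v * y) / (x - y) - (x + y) * (u - v) / (x - y) = u + v"
    using nz by (simp add: algebra_simps flip: diff_divide_distrib) (simp add: field_simps)
  ultimately show ?thesis
    unfolding Bm B2m Bnext B2mn u_def[symmetric] v_def[symmetric] by simp
qed

text \<open>
  The form that the binomial expansion takes for balancing numbers before the companion
  numbers are eliminated.
\<close>

lemma balancing_even_power:
  "real_of_int (balancing n) ^ (2 * l) =
    ((\<Sum>s<l. (-1) ^ s * of_nat ((2 * l) choose s) *
        (\<alpha> ^ (2 * (l - s) * n) + \<beta> ^ (2 * (l - s) * n)))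
     + (-1) ^ l * of_nat ((2 * l) choose l)) / 2 ^ (5 * l)"
proof -
  have "\<alpha> ^ n * \<beta> ^ n = 1"
    by (simp only: balancing_roots_mult power_one flip: power_mult_distrib)
  from even_power_diff_reciprocal[OF this, of l] show ?thesis
    by (simp only: balancing_Binet power_divide balancing_roots_diff_power
        mult.commute[of _ n] flip: power_mult)
qed

theorem theorem2:
  fixes n l :: nat
  assumes "l \<ge> 1"
  shows "B n ^ (2 * l) =
      2 / 2 ^ (5 * l) *
        (\<Sum>s<l. (-1) ^ s * of_nat ((2 * l) choose s) / B (2 * (l - s)) *
                (B (2 * (l - s) * n) + B (2 * (l - s) * (n + 1))))
    + 1 / 2 ^ (5 * l) *
        (\<Sum>s<l. (-1) powi (int s - 1) * of_nat ((2 * l) choose s) * B (2 * (l - s)) /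
                (B (l - s))\<^sup>2 * B (2 * (l - s) * n))
    + (-1) ^ l / 2 ^ (5 * l) * of_nat ((2 * l) choose l)"
proof -
  define p where "p s = 2 / B (2 * (l - s)) * (B (2 * (l - s) * n) + B (2 * (l - s) * (n + 1)))" for s
  define q where "q s = B (2 * (l - s)) / (B (l - s))\<^sup>2 * B (2 * (l - s) * n)" for s
  define c :: "nat \<Rightarrow> rat" where "c s = (-1) ^ s * of_nat ((2 * l) choose s)" for s
  have "\<alpha> ^ (2 * (l - s) * n) + \<beta> ^ (2 * (l - s) * n) = of_rat (p s - q s)" if "s < l" for s
    using companion_as_balancing[of "l - s" n] that
    by (simp add: p_def q_def of_rat_add of_rat_diff of_rat_mult of_rat_divide of_rat_power)
  then have "real_of_int (balancing n) ^ (2 * l) =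
      of_rat (((\<Sum>s<l. c s * (p s - q s)) + c l) / 2 ^ (5 * l))"
    unfolding balancing_even_power c_def
    by (simp add: of_rat_add of_rat_sum of_rat_mult of_rat_divide of_rat_power of_rat_minus)
  then have "of_rat (B n ^ (2 * l)) =
      (of_rat (((\<Sum>s<l. c s * (p s - q s)) + c l) / 2 ^ (5 * l)) :: real)"
    by (simp add: of_rat_power)
  then have "B n ^ (2 * l) = ((\<Sum>s<l. c s * (p s - q s)) + c l) / 2 ^ (5 * l)"
    by (simp only: of_rat_eq_iff)
  also have "\<dots> = 1 / 2 ^ (5 * l) * (\<Sum>s<l. c s * p s) + 1 / 2 ^ (5 * l) * (\<Sum>s<l. - c s * q s)
      + c l / 2 ^ (5 * l)"
    by (simp add: right_diff_distrib sum_subtractf sum_negf add_divide_distrib diff_divide_distrib)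
  also have "(\<Sum>s<l. c s * p s) =
      2 * (\<Sum>s<l. (-1) ^ s * of_nat ((2 * l) choose s) / B (2 * (l - s)) *
                (B (2 * (l - s) * n) + B (2 * (l - s) * (n + 1))))"
    unfolding sum_distrib_left by (rule sum.cong) (simp_all add: c_def p_def)
  also have "(\<Sum>s<l. - c s * q s) =
      (\<Sum>s<l. (-1) powi (int s - 1) * of_nat ((2 * l) choose s) * B (2 * (l - s)) /
                (B (l - s))\<^sup>2 * B (2 * (l - s) * n))"
    by (rule sum.cong) (simp_all add: c_def q_def power_int_diff)
  finally show ?thesis by (simp add: c_def)
qed

end
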